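(* Let $k$ be a field and let $X_1,\ldots,X_n,Y_1,\ldots,Y_n$ be monomials of degree at least $1$ in the variables of $k[u_1,\ldots,u_d]$, where $n\ge 3$. Let $$A=\begin{pmatrix}X_1&X_2&\cdots&X_n\\ Y_1&Y_2&\cdots&Y_n\end{pmatrix},$$ and suppose that the set $F=\{X_iY_j-X_jY_i : i\neq j\}$ of $2\times 2$ minors of $A$ consists of irreducible binomials. Then $F$ is robust if and only if the monomials $X_1,\ldots,X_n,Y_1,\ldots,Y_n$ are pairwise relatively prime.
   Context: A set $F$ of polynomials is robust if it is a Gröbner basis of the ideal $(F)$ with respect to every monomial term order and its elements minimally generate $(F)$.
   Formalization: F is taken with one minor per pair of columns (i<j) rather than all i≠j, since with i≠j the set contains both f and −f and could never minimally generate its ideal in characteristic other than 2. *)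

theory Defs
  imports "HOL-Library.Poly_Mapping" "HOL-Computational_Algebra.Factorial_Ring"
begin

text \<open>Polynomials over a field 'k in the finitely many variables of type 'v
  (so d = CARD('v)): exponent vectors are finitely supported maps 'v to nat, polynomials are
  finitely supported maps from exponent vectors to coefficients.\<close>

type_synonym ('v, 'k) mpoly = "('v \<Rightarrow>\<^sub>0 nat) \<Rightarrow>\<^sub>0 'k"

definition mon :: "('v \<Rightarrow>\<^sub>0 nat) \<Rightarrow> ('v, 'k::field) mpoly" where
  "mon a = Poly_Mapping.single a 1"

definition ideal_gen :: "('v, 'k::field) mpoly set \<Rightarrow> ('v, 'k) mpoly set" where
  "ideal_gen F = {p. \<exists>S c. finite S \<and> S \<subseteq> F \<and> p = (\<Sum>f\<in>S. c f * f)}"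

definition term_order :: "(('v \<Rightarrow>\<^sub>0 nat) \<Rightarrow> ('v \<Rightarrow>\<^sub>0 nat) \<Rightarrow> bool) \<Rightarrow> bool" where
  "term_order le \<longleftrightarrow>
     (\<forall>a. le a a) \<and> (\<forall>a b. le a b \<and> le b a \<longrightarrow> a = b) \<and>
     (\<forall>a b c. le a b \<and> le b c \<longrightarrow> le a c) \<and> (\<forall>a b. le a b \<or> le b a) \<and>
     (\<forall>a. le 0 a) \<and> (\<forall>a b c. le a b \<longrightarrow> le (a + c) (b + c))"

definition lead_mon :: "(('v \<Rightarrow>\<^sub>0 nat) \<Rightarrow> ('v \<Rightarrow>\<^sub>0 nat) \<Rightarrow> bool) \<Rightarrow> ('v, 'k::field) mpoly \<Rightarrow> ('v \<Rightarrow>\<^sub>0 nat)" where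
  "lead_mon le f = (THE m. m \<in> Poly_Mapping.keys f \<and> (\<forall>m'\<in>Poly_Mapping.keys f. le m' m))"

definition groebner_basis :: "(('v \<Rightarrow>\<^sub>0 nat) \<Rightarrow> ('v \<Rightarrow>\<^sub>0 nat) \<Rightarrow> bool) \<Rightarrow> ('v, 'k::field) mpoly set \<Rightarrow> ('v, 'k) mpoly set \<Rightarrow> bool" where
  "groebner_basis le G I \<longleftrightarrow> G \<subseteq> I \<and>
     (\<forall>f\<in>I. f \<noteq> 0 \<longrightarrow> (\<exists>g\<in>G. g \<noteq> 0 \<and> (\<exists>c. lead_mon le f = lead_mon le g + c)))"

definition minimally_generates :: "('v, 'k::field) mpoly set \<Rightarrow> bool" where
  "minimally_generates F \<longleftrightarrow> (\<forall>f\<in>F. f \<notin> ideal_gen (F - {f}))"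

definition robust :: "('v, 'k::field) mpoly set \<Rightarrow> bool" where
  "robust F \<longleftrightarrow> (\<forall>le. term_order le \<longrightarrow> groebner_basis le F (ideal_gen F)) \<and> minimally_generates F"

text \<open>Relatively prime (literal unfolding of the library notion coprime, which is only
  available on algebraic_semidom): every common divisor is a unit.\<close>
definition rel_prime :: "('v, 'k::field) mpoly \<Rightarrow> ('v, 'k) mpoly \<Rightarrow> bool" where
  "rel_prime p q \<longleftrightarrow> (\<forall>c. c dvd p \<longrightarrow> c dvd q \<longrightarrow> c dvd 1)"

definition binomial :: "('v, 'k::field) mpoly \<Rightarrow> bool" where
  "binomial f \<longleftrightarrow> card (Poly_Mapping.keys f) = 2"

end

theory Submission
  imports Defs
begin

text \<open>
  Irreducibility of the minors already makes the entries of each row, and the two entries of each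
  column, pairwise coprime.

  If all entries are pairwise coprime, every monomial has well-defined exponents \<open>a\<^sub>i\<close>, \<open>b\<^sub>i\<close> of the
  highest powers of \<open>X\<^sub>i\<close>, \<open>Y\<^sub>i\<close> dividing it. Replacing \<open>X\<^sub>iY\<^sub>j\<close> by \<open>X\<^sub>jY\<^sub>i\<close> preserves all
  \<open>a\<^sub>i + b\<^sub>i\<close>, the sum of the \<open>a\<^sub>i\<close>, and the cofactor. The leading monomial \<open>m\<close> of an element of the
  ideal shares these invariants with some smaller monomial \<open>m'\<close>, and then there are \<open>i\<close>, \<open>j\<close> such
  that \<open>X\<^sub>iY\<^sub>j\<close> divides \<open>m\<close> and \<open>X\<^sub>jY\<^sub>i\<close> divides \<open>m'\<close>. Either the former is a leading monomial, or
  \<open>m'\<close> can be replaced by a still smaller monomial whose exponents are closer to those of \<open>m\<close>.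

  Conversely, let \<open>u\<close> divide \<open>X\<^sub>p\<close> and \<open>Y\<^sub>q\<close>. For each further column \<open>k\<close>, eliminating \<open>u\<close> from the
  minors \<open>pk\<close> and \<open>kq\<close> gives a binomial of the ideal. Under a lexicographic order with \<open>u\<close> first its
  leading monomial can only be divided by leading monomials of minors avoiding the columns \<open>p\<close>, \<open>q\<close>.
  Varying \<open>k\<close> and the order, this first forces the supports to match in pairs, so that \<open>X\<^sub>p\<close>, \<open>Y\<^sub>q\<close> and
  \<open>X\<^sub>q\<close>, \<open>Y\<^sub>p\<close> have the same support, and then forces the exponents to be proportional. Hence the
  minor \<open>pq\<close> is \<open>z\<^sup>m - w\<^sup>m\<close> with \<open>m \<ge> 2\<close>, which is reducible.
\<close>

abbreviation lookup where "lookup \<equiv> Poly_Mapping.lookup"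
abbreviation keys where "keys \<equiv> Poly_Mapping.keys"

section \<open>Monomials and coefficient sums\<close>

lemma keys_empty_iff: "keys z = {} \<longleftrightarrow> z = 0"
  by (metis all_not_in_conv in_keys_iff keys_zero lookup_zero poly_mapping_eqI)

lemma mon_mult: "mon a * mon b = mon (a + b)"
  by (simp add: mon_def mult_single)

lemma lookup_mon: "lookup (mon a) m = (if m = a then 1 else 0)"
  by (simp add: mon_def lookup_single when_def)

lemma keys_mon_diff:
  assumes "a \<noteq> b"
  shows "keys (mon a - mon b :: ('v, 'k::field) mpoly) = {a, b}"
  using assms by (auto simp: in_keys_iff lookup_minus lookup_mon split: if_splits)

text \<open>Linear functional used to refute membership in an ideal: it vanishes on the ideal as
  soon as \<open>S\<close> is closed under exchanging the two terms of each generator.\<close>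

definition coeff_sum :: "('v \<Rightarrow>\<^sub>0 nat) set \<Rightarrow> ('v, 'k::field) mpoly \<Rightarrow> 'k" where
  "coeff_sum S p = (\<Sum>m\<in>keys p. if m \<in> S then lookup p m else 0)"

lemma coeff_sum_superset:
  assumes "finite K" "keys p \<subseteq> K"
  shows "coeff_sum S p = (\<Sum>m\<in>K. if m \<in> S then lookup p m else 0)"
  unfolding coeff_sum_def
  by (rule sum.mono_neutral_left) (use assms in \<open>auto simp: in_keys_iff\<close>)

lemma coeff_sum_zero [simp]: "coeff_sum S 0 = 0"
  by (simp add: coeff_sum_def)

lemma coeff_sum_add: "coeff_sum S (p + q) = coeff_sum S p + coeff_sum S q"
proof -
  let ?K = "keys p \<union> keys q"
  have "keys (p + q) \<subseteq> ?K"
    by (rule keys_add)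
  then show ?thesis
    by (simp add: coeff_sum_superset[of ?K] sum.distrib[symmetric] lookup_add if_distrib cong: sum.cong)
      (rule sum.cong, auto simp: lookup_add)
qed

lemma coeff_sum_sum: "coeff_sum S (sum f A) = (\<Sum>x\<in>A. coeff_sum S (f x))"
  by (induction A rule: infinite_finite_induct) (auto simp: coeff_sum_add)

lemma coeff_sum_single: "coeff_sum S (Poly_Mapping.single m c) = (if m \<in> S then c else 0)"
  by (simp add: coeff_sum_def)

lemma coeff_sum_diff: "coeff_sum S (p - q) = coeff_sum S p - coeff_sum S q"
  using coeff_sum_add[of S "p - q" q] by simp

lemma poly_mapping_sum_single: "p = (\<Sum>m\<in>keys p. Poly_Mapping.single m (lookup p m))"
  by (rule poly_mapping_eqI)
    (auto simp: lookup_sum lookup_single when_def in_keys_iff sum.delta)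

text \<open>Each term of \<open>c\<close> contributes opposite coefficients at \<open>t + a\<close>
  and \<open>t + b\<close>, and \<open>S\<close> contains both or neither.\<close>

lemma coeff_sum_mult_mon_diff:
  assumes "\<And>t. t + a \<in> S \<longleftrightarrow> t + b \<in> S"
  shows "coeff_sum S (c * (mon a - mon b)) = 0"
proof -
  have "c * (mon a - mon b) =
      (\<Sum>m\<in>keys c. Poly_Mapping.single m (lookup c m) * (mon a - mon b))"
    by (subst poly_mapping_sum_single[of c]) (simp add: sum_distrib_right)
  also have "\<dots> = (\<Sum>m\<in>keys c. Poly_Mapping.single (m + a) (lookup c m)
      - Poly_Mapping.single (m + b) (lookup c m))"
    by (simp add: mon_def right_diff_distrib mult_single)
  also have "coeff_sum S \<dots> = 0"
    by (simp add: coeff_sum_sum coeff_sum_diff coeff_sum_single assms)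
  finally show ?thesis .
qed

lemma coeff_sum_ideal_gen:
  assumes "p \<in> ideal_gen F"
    and "\<And>f. f \<in> F \<Longrightarrow> \<exists>a b. f = mon a - mon b \<and> (\<forall>t. t + a \<in> S \<longleftrightarrow> t + b \<in> S)"
  shows "coeff_sum S p = 0"
proof -
  obtain T c where T: "T \<subseteq> F" "p = (\<Sum>f\<in>T. c f * f)"
    using assms(1) by (auto simp: ideal_gen_def)
  have "coeff_sum S (c f * f) = 0" if "f \<in> T" for f
    using assms(2)[of f] T(1) that coeff_sum_mult_mon_diff by blast
  then show ?thesis
    by (simp add: T(2) coeff_sum_sum)
qed

section \<open>Units, divisors of monomials and coprimality\<close>

text \<open>For \<open>S = UNIV\<close> the functional evaluates at the all-ones point, which kills
  the difference but not \<open>1\<close>.\<close>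

lemma mon_diff_not_unit: "\<not> (mon a - mon b :: ('v, 'k::field) mpoly) dvd 1"
proof
  assume "(mon a - mon b :: ('v, 'k) mpoly) dvd 1"
  then obtain c :: "('v, 'k) mpoly" where c: "1 = (mon a - mon b) * c" ..
  have "coeff_sum UNIV (1 :: ('v, 'k) mpoly) = 0"
    unfolding c using coeff_sum_mult_mon_diff[of a UNIV b c] by (simp add: mult.commute)
  then show False
    by (simp add: coeff_sum_def)
qed

lemma exponent_add_eq_0:
  fixes a b :: "'v \<Rightarrow>\<^sub>0 nat"
  assumes "a + b = 0"
  shows "a = 0"
proof (rule poly_mapping_eqI)
  show "lookup a k = lookup 0 k" for k
    using arg_cong[OF assms, of "\<lambda>m. lookup m k"] by (simp add: lookup_add)
qed

text \<open>Exponents are nonnegative, so a constant term of a product needs constant terms in both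
  factors.\<close>

lemma not_unit_if_const_coeff_0:
  fixes p :: "('v, 'k::field) mpoly"
  assumes "lookup p 0 = 0"
  shows "\<not> p dvd 1"
proof
  assume "p dvd 1"
  then obtain c where "1 = p * c" ..
  then have "0 \<in> keys (p * c)"
    by (metis keys_one singletonI)
  then obtain a b where ab: "0 = a + b" "a \<in> keys p"
    using keys_mult[of p c] by auto
  have "a = 0"
    using exponent_add_eq_0[OF ab(1)[symmetric]] .
  with ab(2) assms show False
    by (simp add: in_keys_iff)
qed

lemma mon_not_unit:
  assumes "a \<noteq> 0"
  shows "\<not> (mon a :: ('v, 'k::field) mpoly) dvd 1"
  by (rule not_unit_if_const_coeff_0) (use assms in \<open>simp add: lookup_mon\<close>)

lemma exponent_le_obtain:
  fixes a b :: "'v \<Rightarrow>\<^sub>0 nat"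
  assumes "\<And>v. lookup a v \<le> lookup b v"
  obtains c where "b = a + c"
proof
  show "b = a + (b - a)"
    by (rule poly_mapping_eqI) (use assms in \<open>simp add: lookup_add lookup_minus\<close>)
qed

lemma variable_factor_obtain:
  fixes a :: "'v \<Rightarrow>\<^sub>0 nat"
  assumes "v \<in> keys a"
  obtains b where "a = Poly_Mapping.single v 1 + b"
  by (rule exponent_le_obtain[of "Poly_Mapping.single v 1" a])
    (use assms in \<open>auto simp: lookup_single when_def in_keys_iff\<close>)

lemma single_1_not_0: "Poly_Mapping.single v (1 :: nat) \<noteq> 0"
  by (metis lookup_single_eq lookup_zero zero_neq_one)

section \<open>Lexicographic orders and general term orders\<close>

fun lex_le :: "'v list \<Rightarrow> ('v \<Rightarrow>\<^sub>0 nat) \<Rightarrow> ('v \<Rightarrow>\<^sub>0 nat) \<Rightarrow> bool" where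
  "lex_le [] a b \<longleftrightarrow> True"
| "lex_le (x # xs) a b \<longleftrightarrow>
     lookup a x < lookup b x \<or> lookup a x = lookup b x \<and> lex_le xs a b"

lemma lex_le_antisym:
  "lex_le xs a b \<Longrightarrow> lex_le xs b a \<Longrightarrow> x \<in> set xs \<Longrightarrow> lookup a x = lookup b x"
  by (induction xs) auto

lemma term_order_lex_le:
  assumes "set xs = UNIV"
  shows "term_order (lex_le xs)"
proof -
  have refl: "lex_le ys a a" for ys :: "'a list" and a
    by (induction ys) auto
  have antisym: "a = b" if "lex_le xs a b" "lex_le xs b a" for a b
    using lex_le_antisym[OF that] assms by (intro poly_mapping_eqI) auto
  have trans: "lex_le ys a b \<Longrightarrow> lex_le ys b c \<Longrightarrow> lex_le ys a c" for ys :: "'a list" and a b c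
    by (induction ys) auto
  have total: "lex_le ys a b \<or> lex_le ys b a" for ys :: "'a list" and a b
    by (induction ys) auto
  have zero: "lex_le ys 0 a" for ys :: "'a list" and a
    by (induction ys) auto
  have add: "lex_le ys a b \<Longrightarrow> lex_le ys (a + c) (b + c)" for ys :: "'a list" and a b c
    by (induction ys) (auto simp: lookup_add)
  show ?thesis
    unfolding term_order_def
    by (intro conjI allI impI; (elim conjE)?; (rule refl total zero add antisym; assumption?)?)
      (rule trans)
qed

text \<open>The prefix \<open>vs\<close> prescribes the dominant variables and \<open>us\<close>
  breaks ties; a repeated variable is harmless, being compared again only after it has already
  tied.\<close>

lemma exists_lex_le: "\<exists>us :: 'v::finite list. \<forall>vs. term_order (lex_le (vs @ us))"
proof -
  obtain us :: "'v list" where "set us = UNIV"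
    using finite_list[of "UNIV :: 'v set"] by auto
  then have "\<forall>vs. term_order (lex_le (vs @ us))"
    by (auto intro: term_order_lex_le)
  then show ?thesis ..
qed

lemma term_orderD:
  assumes "term_order le"
  shows "le a a" "le a b \<Longrightarrow> le b a \<Longrightarrow> a = b" "le a b \<Longrightarrow> le b c \<Longrightarrow> le a c"
    "le a b \<or> le b a" "le a b \<Longrightarrow> le (a + c) (b + c)"
proof -
  have "\<forall>a. le a a" and antisym: "\<forall>a b. le a b \<and> le b a \<longrightarrow> a = b"
    and trans: "\<forall>a b c. le a b \<and> le b c \<longrightarrow> le a c" and "\<forall>a b. le a b \<or> le b a"
    and add: "\<forall>a b c. le a b \<longrightarrow> le (a + c) (b + c)"
    using assms unfolding term_order_def by - (elim conjE, assumption)+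
  then show "le a a" "le a b \<or> le b a"
    by iprover+
  show "le a b \<Longrightarrow> le b a \<Longrightarrow> a = b"
    using antisym by iprover
  show "le a b \<Longrightarrow> le b c \<Longrightarrow> le a c"
    using trans by iprover
  show "le a b \<Longrightarrow> le (a + c) (b + c)"
    using add by iprover
qed

text \<open>Guarantees that the extreme exponents of two factors form a sum that arises from no
  other pair.\<close>

lemma term_order_strict_mono:
  assumes "term_order le" "le a b" "le c d" "a + c = b + d"
  shows "a = b \<and> c = d"
proof -
  have "le (a + c) (b + c)"
    using term_orderD(5)[OF assms(1,2)] .
  moreover have "le (b + c) (a + c)"
    using term_orderD(5)[OF assms(1,3), of b] by (simp add: add.commute assms(4))
  ultimately have "b + c = b + d"
    using term_orderD(2)[OF assms(1)] assms(4) by metis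
  then show ?thesis
    using assms(4) by auto
qed

lemma exists_greatest:
  assumes "\<And>a b. le a b \<or> le b a" "\<And>a b c. le a b \<Longrightarrow> le b c \<Longrightarrow> le a c"
    and "finite A" "A \<noteq> {}"
  shows "\<exists>m\<in>A. \<forall>m'\<in>A. le m' m"
  using assms(3,4)
proof (induction A rule: finite_ne_induct)
  case (singleton x)
  show ?case
    using assms(1)[of x x] by simp
next
  case (insert x A)
  then obtain m where m: "m \<in> A" "\<forall>m'\<in>A. le m' m"
    by blast
  show ?case
  proof (cases "le x m")
    case False
    then have "le m x" "le x x"
      using assms(1) by blast+
    then show ?thesis
      using m assms(2) by (intro bexI[of _ x]) blast+
  qed (use m in auto)
qed

lemma exists_max_key:
  assumes "term_order le" "finite A" "A \<noteq> {}"
  shows "\<exists>m\<in>A. \<forall>m'\<in>A. le m' m"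
  using exists_greatest[of le, OF term_orderD(4,3)[OF assms(1)] assms(2,3)] .

lemma exists_min_key:
  assumes "term_order le" "finite A" "A \<noteq> {}"
  shows "\<exists>m\<in>A. \<forall>m'\<in>A. le m m'"
proof (rule exists_greatest[where le = "\<lambda>a b. le b a", OF _ _ assms(2,3)])
  show "le b a \<or> le a b" for a b
    by (rule term_orderD(4)[OF assms(1)])
  show "le b a \<Longrightarrow> le c b \<Longrightarrow> le c a" for a b c
    by (rule term_orderD(3)[OF assms(1)])
qed

section \<open>Divisors of monomials\<close>

lemma in_keys_mult_if_unique:
  fixes p q :: "('v, 'k::field) mpoly"
  assumes "a \<in> keys p" "b \<in> keys q"
    and "\<And>a' b'. a' \<in> keys p \<Longrightarrow> b' \<in> keys q \<Longrightarrow> a' + b' = a + b \<Longrightarrow> a' = a \<and> b' = b"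
  shows "a + b \<in> keys (p * q)"
proof -
  define p' where "p' = p - Poly_Mapping.single a (lookup p a)"
  define q' where "q' = q - Poly_Mapping.single b (lookup q b)"
  have p': "keys p' \<subseteq> keys p - {a}"
    by (auto simp: p'_def in_keys_iff lookup_minus lookup_single when_def split: if_splits)
  have q': "keys q' \<subseteq> keys q - {b}"
    by (auto simp: q'_def in_keys_iff lookup_minus lookup_single when_def split: if_splits)
  have "a + b \<notin> keys (p' * q)"
    using p' assms(3) keys_mult[of p' q] by fastforce
  moreover have "a + b \<notin> keys (Poly_Mapping.single a (lookup p a) * q')"
    using q' keys_mult[of "Poly_Mapping.single a (lookup p a)" q'] by (force split: if_splits)
  \<comment> \<open>Splitting off one term of each factor isolates the only product that reaches
    \<open>a + b\<close>, so nothing cancels it.\<close>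
  moreover have "p * q = p' * q + Poly_Mapping.single a (lookup p a) * q'
      + Poly_Mapping.single (a + b) (lookup p a * lookup q b)"
    by (simp add: p'_def q'_def algebra_simps mult_single)
  ultimately have "lookup (p * q) (a + b) = lookup p a * lookup q b"
    by (simp add: lookup_add in_keys_iff)
  then show ?thesis
    using assms(1,2) by (simp add: in_keys_iff)
qed

text \<open>The greatest exponents of both factors add up to an exponent of the product, and so do
  the least ones. The product has only one exponent, so greatest and least coincide.\<close>

lemma dvd_mon_obtain:
  fixes p :: "('v::finite, 'k::field) mpoly"
  assumes "p dvd mon a"
  obtains m c b where "p = Poly_Mapping.single m c" "c \<noteq> 0" "a = m + b"
proof -
  obtain q where q: "mon a = p * q"
    using assms ..
  have "mon a \<noteq> (0 :: ('v, 'k) mpoly)"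
    by (metis lookup_mon lookup_zero zero_neq_one)
  then have ne: "keys p \<noteq> {}" "keys q \<noteq> {}"
    using q by auto
  obtain le :: "('v \<Rightarrow>\<^sub>0 nat) \<Rightarrow> ('v \<Rightarrow>\<^sub>0 nat) \<Rightarrow> bool" where le: "term_order le"
    using exists_lex_le by blast
  obtain m1 m2 where max: "m1 \<in> keys p" "\<forall>m\<in>keys p. le m m1" "m2 \<in> keys q" "\<forall>m\<in>keys q. le m m2"
    using exists_max_key[OF le] ne by (metis finite_keys)
  obtain l1 l2 where min: "l1 \<in> keys p" "\<forall>m\<in>keys p. le l1 m" "l2 \<in> keys q" "\<forall>m\<in>keys q. le l2 m"
    using exists_min_key[OF le] ne by (metis finite_keys)
  have "m1 + m2 \<in> keys (p * q)"
    by (rule in_keys_mult_if_unique) (use max term_order_strict_mono[OF le] in blast)+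
  then have max_eq: "m1 + m2 = a"
    by (simp flip: q add: mon_def)
  have "l1 + l2 \<in> keys (p * q)"
    by (rule in_keys_mult_if_unique) (use min term_order_strict_mono[OF le] in \<open>metis (no_types)\<close>)+
  then have "l1 + l2 = a"
    by (simp flip: q add: mon_def)
  then have "l1 = m1"
    using term_order_strict_mono[OF le, of l1 m1 l2 m2] max min max_eq by simp
  then have "keys p = {m1}"
    using max min term_orderD(2)[OF le] by blast
  then have "p = Poly_Mapping.single m1 (lookup p m1)"
    by (subst poly_mapping_sum_single[of p]) simp
  then show ?thesis
    using that[of m1 "lookup p m1" m2] max(1) max_eq by (auto simp: in_keys_iff)
qed

text \<open>A shared variable is a common non-unit. Conversely a common divisor is a single term
  whose exponent lies below \<open>a\<close> and \<open>b\<close>, hence is constant.\<close>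

lemma rel_prime_mon_iff:
  fixes a b :: "'v::finite \<Rightarrow>\<^sub>0 nat"
  shows "rel_prime (mon a :: ('v, 'k::field) mpoly) (mon b) \<longleftrightarrow> keys a \<inter> keys b = {}"
proof
  assume prime: "rel_prime (mon a :: ('v, 'k) mpoly) (mon b)"
  have "v \<notin> keys b" if v: "v \<in> keys a" for v
  proof
    assume v': "v \<in> keys b"
    have "mon (Poly_Mapping.single v 1) dvd (mon c :: ('v, 'k) mpoly)" if "v \<in> keys c" for c
      using that by (metis variable_factor_obtain mon_mult dvd_triv_left)
    then have "mon (Poly_Mapping.single v 1) dvd (1 :: ('v, 'k) mpoly)"
      using prime v v' by (auto simp: rel_prime_def)
    then show False
      by (rule mon_not_unit[OF single_1_not_0, THEN notE])
  qed
  then show "keys a \<inter> keys b = {}"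
    by blast
next
  assume disj: "keys a \<inter> keys b = {}"
  show "rel_prime (mon a :: ('v, 'k) mpoly) (mon b)"
    unfolding rel_prime_def
  proof (intro allI impI)
    fix p :: "('v, 'k) mpoly"
    assume pa: "p dvd mon a" and pb: "p dvd mon b"
    obtain m c a' where p: "p = Poly_Mapping.single m c" "c \<noteq> 0" "a = m + a'"
      using pa by (rule dvd_mon_obtain)
    obtain m' c' b' where p': "p = Poly_Mapping.single m' c'" "c' \<noteq> 0" "b = m' + b'"
      using pb by (rule dvd_mon_obtain)
    have "keys p = {m}" "keys p = {m'}"
      by (subst p(1) p'(1), simp add: p(2) p'(2))+
    then have "m' = m"
      by simp
    then have "lookup m v = 0" for v
      using disj p(3) p'(3) by (auto simp: in_keys_iff lookup_add disjoint_iff)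
    then have "m = 0"
      by (intro poly_mapping_eqI) simp
    then have "1 = p * Poly_Mapping.single 0 (inverse c)"
      using p by (simp add: mult_single)
    then show "p dvd 1" ..
  qed
qed

section \<open>Leading monomials\<close>

lemma lead_mon_eqI:
  assumes "term_order le" "m \<in> keys f" "\<And>m'. m' \<in> keys f \<Longrightarrow> le m' m"
  shows "lead_mon le f = m"
  unfolding lead_mon_def
proof (rule the_equality)
  fix l
  assume l: "l \<in> keys f \<and> (\<forall>m'\<in>keys f. le m' l)"
  show "l = m"
    by (rule term_orderD(2)[OF assms(1)]) (use l assms(2,3) in auto)
qed (use assms in simp)

lemma lead_mon_in_keys:
  assumes "term_order le" "f \<noteq> 0"
  shows "lead_mon le f \<in> keys f" "m \<in> keys f \<Longrightarrow> le m (lead_mon le f)"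
proof -
  have "keys f \<noteq> {}"
    using assms(2) by (simp add: keys_empty_iff)
  then obtain l where l: "l \<in> keys f" "\<forall>m'\<in>keys f. le m' l"
    using exists_max_key[OF assms(1)] finite_keys by blast
  then have "lead_mon le f = l"
    by (intro lead_mon_eqI[OF assms(1)]) auto
  with l show "lead_mon le f \<in> keys f" "m \<in> keys f \<Longrightarrow> le m (lead_mon le f)"
    by auto
qed

lemma lead_mon_mon_diff:
  assumes "term_order le" "a \<noteq> b" "le b a"
  shows "lead_mon le (mon a - mon b :: ('v, 'k::field) mpoly) = a"
    and "lead_mon le (mon b - mon a :: ('v, 'k::field) mpoly) = a"
  by (rule lead_mon_eqI[OF assms(1)]; use assms(2,3) term_orderD(1)[OF assms(1)] in
    \<open>auto simp: keys_mon_diff\<close>)+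


section \<open>Pairwise coprime entries\<close>

text \<open>Taking \<open>i < j\<close> keeps one sign of each minor, since \<open>f\<close> and
  \<open>- f\<close> would be redundant generators.\<close>

definition minors :: "(nat \<Rightarrow> ('v \<Rightarrow>\<^sub>0 nat)) \<Rightarrow> (nat \<Rightarrow> ('v \<Rightarrow>\<^sub>0 nat)) \<Rightarrow> nat \<Rightarrow> ('v, 'k::field) mpoly set" where
  "minors X Y n = {mon (X i + Y j) - mon (X j + Y i) | i j. i < j \<and> j < n}"

lemma minorsI: "i < j \<Longrightarrow> j < n \<Longrightarrow> mon (X i + Y j) - mon (X j + Y i) \<in> minors X Y n"
  by (auto simp: minors_def)

text \<open>The largest power of \<open>z\<close> dividing \<open>m\<close>: the worst quotient over
  the variables of \<open>z\<close>. For \<open>z = 0\<close> it is a minimum of the empty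
  set.\<close>

definition max_power :: "('v \<Rightarrow>\<^sub>0 nat) \<Rightarrow> ('v \<Rightarrow>\<^sub>0 nat) \<Rightarrow> nat" where
  "max_power z m = Min ((\<lambda>v. lookup m v div lookup z v) ` keys z)"

lemma max_power_add_self:
  assumes "z \<noteq> 0"
  shows "max_power z (m + z) = Suc (max_power z m)"
proof -
  have "(\<lambda>v. lookup (m + z) v div lookup z v) ` keys z =
      Suc ` (\<lambda>v. lookup m v div lookup z v) ` keys z"
    unfolding image_image by (intro image_cong) (auto simp: lookup_add in_keys_iff div_add_self2)
  moreover have "Min (Suc ` A) = Suc (Min A)" if "finite A" "A \<noteq> {}" for A
    using mono_Min_commute[OF mono_Suc that] by simp
  ultimately show ?thesis
    using assms by (simp add: max_power_def keys_empty_iff)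
qed

lemma max_power_add_disjoint:
  assumes "keys z \<inter> keys w = {}"
  shows "max_power z (m + w) = max_power z m"
proof -
  have "lookup (m + w) v = lookup m v" if "v \<in> keys z" for v
    using that assms by (auto simp: lookup_add in_keys_iff disjoint_iff)
  then show ?thesis
    by (simp add: max_power_def cong: image_cong)
qed

lemma max_power_zero:
  assumes "z \<noteq> 0"
  shows "max_power z 0 = 0"
  using assms by (simp add: max_power_def keys_empty_iff)

lemma lookup_le_if_max_power_pos:
  assumes "max_power z m > 0"
  shows "lookup z v \<le> lookup m v"
proof (cases "v \<in> keys z")
  case True
  then have "max_power z m \<le> lookup m v div lookup z v"
    by (auto simp: max_power_def)
  with assms have "lookup m v div lookup z v > 0"
    by simp
  then show ?thesis
    by (simp add: div_greater_zero_iff)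
qed (simp add: in_keys_iff)

locale coprime_matrix =
  fixes X Y :: "nat \<Rightarrow> ('v \<Rightarrow>\<^sub>0 nat)" and n :: nat
  assumes X_nz: "i < n \<Longrightarrow> X i \<noteq> 0" and Y_nz: "i < n \<Longrightarrow> Y i \<noteq> 0"
    and XY: "i < n \<Longrightarrow> j < n \<Longrightarrow> keys (X i) \<inter> keys (Y j) = {}"
    and XX: "i < n \<Longrightarrow> j < n \<Longrightarrow> i \<noteq> j \<Longrightarrow> keys (X i) \<inter> keys (X j) = {}"
    and YY: "i < n \<Longrightarrow> j < n \<Longrightarrow> i \<noteq> j \<Longrightarrow> keys (Y i) \<inter> keys (Y j) = {}"
begin

abbreviation "xpow i m \<equiv> max_power (X i) m"
abbreviation "ypow i m \<equiv> max_power (Y i) m"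

lemma xpow_add:
  assumes "i < n" "j < n" "k < n"
  shows "xpow k (t + (X i + Y j)) = xpow k t + (if k = i then 1 else 0)"
proof -
  have "xpow k (t + (X i + Y j)) = xpow k (t + X i)"
    using max_power_add_disjoint[of "X k" "Y j" "t + X i"] XY assms by (simp add: add.assoc)
  then show ?thesis
    using max_power_add_self[of "X i" t] max_power_add_disjoint[of "X k" "X i" t] X_nz XX assms
    by auto
qed

lemma ypow_add:
  assumes "i < n" "j < n" "k < n"
  shows "ypow k (t + (X i + Y j)) = ypow k t + (if k = j then 1 else 0)"
proof -
  have "ypow k (t + (X i + Y j)) = ypow k (t + Y j)"
    using max_power_add_disjoint[of "Y k" "X i" "t + Y j"] XY assms
    by (simp add: ac_simps Int_commute)
  then show ?thesis
    using max_power_add_self[of "Y j" t] max_power_add_disjoint[of "Y k" "Y j" t] Y_nz YY assms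
    by auto
qed

text \<open>With \<open>m = r \<cdot> \<Prod>X\<^sub>i\<^bsup>a\<^sub>i\<^esup>Y\<^sub>i\<^bsup>b\<^sub>i\<^esup>\<close>, the last component is
  \<open>r \<cdot> \<Prod>(X\<^sub>iY\<^sub>i)\<^bsup>a\<^sub>i+b\<^sub>i\<^esup>\<close>; together with the column degrees it records \<open>r\<close> without subtraction.\<close>

definition invariant :: "('v \<Rightarrow>\<^sub>0 nat) \<Rightarrow> nat \<times> (nat \<Rightarrow> nat) \<times> ('v \<Rightarrow> nat)" where
  "invariant m =
    (\<Sum>i<n. xpow i m,
     \<lambda>i. if i < n then xpow i m + ypow i m else 0,
     \<lambda>v. lookup m v + (\<Sum>i<n. ypow i m * lookup (X i) v + xpow i m * lookup (Y i) v))"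

text \<open>The factor \<open>X i + Y j\<close> raises the \<open>i\<close>-th
  \<open>X\<close>-power and the \<open>j\<close>-th \<open>Y\<close>-power by one. The last
  component thereby grows by the exponents of \<open>X i\<close>, \<open>Y j\<close>,
  \<open>X j\<close> and \<open>Y i\<close>, which is symmetric in \<open>i\<close> and
  \<open>j\<close>.\<close>

lemma invariant_swap:
  assumes ij: "i < n" "j < n"
  shows "invariant (t + (X i + Y j)) = invariant (t + (X j + Y i))"
proof -
  have pow_sum: "(\<Sum>k<n. (f k + (if k = l then 1 else 0)) * g k) = (\<Sum>k<n. f k * g k) + g l"
    if "l < n" for f g :: "nat \<Rightarrow> nat" and l
    using that by (simp add: distrib_right sum.distrib if_distrib[of "\<lambda>x. x * _"] sum.delta cong: if_cong)
  have "(\<Sum>k<n. xpow k (t + (X i + Y j))) = (\<Sum>k<n. xpow k (t + (X j + Y i)))"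
    using ij by (simp add: xpow_add sum.distrib)
  moreover have "lookup (t + (X i + Y j)) v + (\<Sum>k<n. ypow k (t + (X i + Y j)) * lookup (X k) v
        + xpow k (t + (X i + Y j)) * lookup (Y k) v)
      = lookup t v + lookup (X i) v + lookup (Y j) v + lookup (X j) v + lookup (Y i) v
        + (\<Sum>k<n. ypow k t * lookup (X k) v) + (\<Sum>k<n. xpow k t * lookup (Y k) v)"
    if "i < n" "j < n" for i j v
  proof -
    have "(\<Sum>k<n. ypow k (t + (X i + Y j)) * lookup (X k) v)
        = (\<Sum>k<n. ypow k t * lookup (X k) v) + lookup (X j) v"
      using pow_sum[of j "\<lambda>k. ypow k t" "\<lambda>k. lookup (X k) v"] that by (simp add: ypow_add)
    moreover have "(\<Sum>k<n. xpow k (t + (X i + Y j)) * lookup (Y k) v)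
        = (\<Sum>k<n. xpow k t * lookup (Y k) v) + lookup (Y i) v"
      using pow_sum[of i "\<lambda>k. xpow k t" "\<lambda>k. lookup (Y k) v"] that by (simp add: xpow_add)
    ultimately show ?thesis
      by (simp add: sum.distrib lookup_add)
  qed
  ultimately show ?thesis
    using ij by (auto simp: invariant_def fun_eq_iff xpow_add ypow_add)
qed

lemma obtain_factor:
  assumes "i < n" "j < n" "xpow i m > 0" "ypow j m > 0"
  obtains t where "m = t + (X i + Y j)"
proof -
  have "lookup (X i + Y j) v \<le> lookup m v" for v
  proof (cases "v \<in> keys (X i)")
    case True
    then have "v \<notin> keys (Y j)"
      using XY[OF assms(1,2)] by blast
    then show ?thesis
      using lookup_le_if_max_power_pos[OF assms(3)] by (simp add: lookup_add in_keys_iff)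
  next
    case False
    then show ?thesis
      using lookup_le_if_max_power_pos[OF assms(4)] by (simp add: lookup_add in_keys_iff)
  qed
  then show ?thesis
    using exponent_le_obtain[of "X i + Y j" m] that by (metis add.commute)
qed

lemma nonminimal_reducible:
  assumes "term_order le" "invariant m' = invariant m" "m' \<noteq> m" "le m' m"
  shows "\<exists>i<n. \<exists>j<n. i \<noteq> j \<and> le (X j + Y i) (X i + Y j) \<and> (\<exists>t. m = t + (X i + Y j))"
  using assms(2-)
\<comment> \<open>Truncated subtraction counts only columns where \<open>m'\<close> has fewer
  \<open>X\<close>-powers than \<open>m\<close>.\<close>
proof (induction "\<Sum>i<n. xpow i m - xpow i m'" arbitrary: m' rule: less_induct)
  case less
  have sum_eq: "(\<Sum>i<n. xpow i m') = (\<Sum>i<n. xpow i m)"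
    using less.prems(1) by (simp add: invariant_def)
  have col: "xpow i m' + ypow i m' = xpow i m + ypow i m" if "i < n" for i
    using less.prems(1) that by (auto simp: invariant_def fun_eq_iff split: if_splits)
  \<comment> \<open>If all \<open>X\<close>-powers agreed, the column sums would make the
    \<open>Y\<close>-powers agree, and the last component would give \<open>m' = m\<close>.\<close>
  have ex_ne: "\<exists>i<n. xpow i m \<noteq> xpow i m'"
  proof (rule ccontr)
    assume "\<not> ?thesis"
    then have eq: "xpow i m' = xpow i m" if "i < n" for i
      using that by auto
    then have eq': "ypow i m' = ypow i m" if "i < n" for i
      using that col by fastforce
    have "lookup m' v = lookup m v" for v
      using less.prems(1) by (simp add: invariant_def fun_eq_iff eq eq')
    then show False
      using less.prems(2) by (auto intro: poly_mapping_eqI)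
  qed
  have "\<exists>i<n. xpow i m' < xpow i m"
  proof (rule ccontr)
    assume "\<not> ?thesis"
    then have "\<forall>i<n. xpow i m \<le> xpow i m'"
      using not_less by blast
    moreover from this have "\<exists>i<n. xpow i m < xpow i m'"
      using ex_ne le_neq_implies_less by blast
    ultimately have "(\<Sum>i<n. xpow i m) < (\<Sum>i<n. xpow i m')"
      by (intro sum_strict_mono_ex1) auto
    then show False
      using sum_eq by simp
  qed
  then obtain i where i: "i < n" "xpow i m' < xpow i m"
    by blast
  have "\<exists>j<n. xpow j m < xpow j m'"
  proof (rule ccontr)
    assume "\<not> ?thesis"
    then have "\<forall>j<n. xpow j m' \<le> xpow j m"
      using not_less by blast
    then have "(\<Sum>i<n. xpow i m') < (\<Sum>i<n. xpow i m)"
      using i by (intro sum_strict_mono_ex1) auto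
    then show False
      using sum_eq by simp
  qed
  then obtain j where j: "j < n" "xpow j m < xpow j m'"
    by blast
  \<comment> \<open>By the fixed column sums, an excess of \<open>X\<close>-powers in one monomial
    is an excess of \<open>Y\<close>-powers in the other.\<close>
  have ij: "i \<noteq> j" and "ypow j m > 0" "ypow i m' > 0"
    using i j col[of i] col[of j] by auto
  then obtain s t where s: "m = s + (X i + Y j)" and t: "m' = t + (X j + Y i)"
    using obtain_factor[of i j m] obtain_factor[of j i m'] i j by (metis gr_zeroI not_less_zero)
  show ?case
  proof (cases "le (X j + Y i) (X i + Y j)")
    case True
    then show ?thesis
      using i j ij s by blast
  next
    case False
    then have le: "le (X i + Y j) (X j + Y i)" and ne: "X i + Y j \<noteq> X j + Y i"
      using term_orderD(1,4)[OF assms(1)] by metis+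
    \<comment> \<open>The move lowers the deficit in column \<open>i\<close>; in column
      \<open>j\<close> the deficit stays zero because \<open>m'\<close> had a strict excess
      there.\<close>
    define m'' where "m'' = t + (X i + Y j)"
    have "le m'' m'"
      using term_orderD(5)[OF assms(1) le, of t] by (simp add: m''_def t add.commute)
    then have "le m'' m"
      using term_orderD(3)[OF assms(1)] less.prems(3) by blast
    moreover have "m'' \<noteq> m"
    proof
      assume "m'' = m"
      then have "m' = m''"
        using \<open>le m'' m'\<close> less.prems(3) term_orderD(2)[OF assms(1)] by blast
      then show False
        using ne by (simp add: m''_def t)
    qed
    moreover have "invariant m'' = invariant m"
      using invariant_swap[of i j t] i j less.prems(1) by (simp add: m''_def t)
    moreover have "(\<Sum>k<n. xpow k m - xpow k m'') < (\<Sum>k<n. xpow k m - xpow k m')"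
    proof (rule sum_strict_mono_ex1)
      show "\<forall>k\<in>{..<n}. xpow k m - xpow k m'' \<le> xpow k m - xpow k m'"
        using i j ij by (auto simp: m''_def t xpow_add)
      show "\<exists>k\<in>{..<n}. xpow k m - xpow k m'' < xpow k m - xpow k m'"
        using i j ij by (intro bexI[of _ i]) (auto simp: m''_def t xpow_add)
    qed simp
    ultimately show ?thesis
      using less.hyps by blast
  qed
qed

section \<open>Robustness from coprimality\<close>

lemma swap_neq:
  assumes "i < n" "j < n" "i \<noteq> j"
  shows "X i + Y j \<noteq> X j + Y i"
proof
  assume "X i + Y j = X j + Y i"
  then have "xpow i (0 + (X i + Y j)) = xpow i (0 + (X j + Y i))"
    by simp
  then show False
    using assms by (simp add: xpow_add del: add_0)
qed

lemma minors_groebner_basis: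
  assumes le: "term_order le"
  shows "groebner_basis le (minors X Y n) (ideal_gen (minors X Y n :: ('v, 'k::field) mpoly set))"
proof -
  let ?F = "minors X Y n :: ('v, 'k) mpoly set"
  have "f \<in> ideal_gen ?F" if "f \<in> ?F" for f
    unfolding ideal_gen_def
    using that by (intro CollectI exI[of _ "{f}"] exI[of _ "\<lambda>_. 1"]) auto
  moreover have "\<exists>g\<in>?F. g \<noteq> 0 \<and> (\<exists>c. lead_mon le f = lead_mon le g + c)"
    if f: "f \<in> ideal_gen ?F" "f \<noteq> 0" for f
  proof -
    define m where "m = lead_mon le f"
    have m: "m \<in> keys f"
      using lead_mon_in_keys[OF le f(2)] by (simp add: m_def)
    define S where "S = {l. invariant l = invariant m}"
    have "coeff_sum S f = 0"
    proof (rule coeff_sum_ideal_gen[OF f(1)])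
      fix g
      assume "g \<in> ?F"
      then obtain i j where "g = mon (X i + Y j) - mon (X j + Y i)" "i < j" "j < n"
        by (auto simp: minors_def)
      moreover have "\<forall>t. t + (X i + Y j) \<in> S \<longleftrightarrow> t + (X j + Y i) \<in> S"
        using invariant_swap[of i j] calculation by (simp add: S_def)
      ultimately show "\<exists>a b. g = mon a - mon b \<and> (\<forall>t. t + a \<in> S \<longleftrightarrow> t + b \<in> S)"
        by blast
    qed
    \<comment> \<open>If the leading monomial were alone in its invariant class, its nonzero
      coefficient would be the whole coefficient sum.\<close>
    have "\<exists>m'\<in>keys f. m' \<noteq> m \<and> m' \<in> S"
    proof (rule ccontr)
      assume "\<not> ?thesis"
      then have "(\<Sum>l\<in>keys f. if l \<in> S then lookup f l else 0)
          = (\<Sum>l\<in>keys f. if l = m then lookup f l else 0)"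
        by (intro sum.cong) (auto simp: S_def)
      then have "coeff_sum S f = lookup f m"
        using m by (simp add: coeff_sum_def)
      then show False
        using \<open>coeff_sum S f = 0\<close> m by (simp add: in_keys_iff)
    qed
    then obtain m' where m': "m' \<in> keys f" "m' \<noteq> m" "invariant m' = invariant m"
      by (auto simp: S_def)
    have "le m' m"
      using lead_mon_in_keys[OF le f(2)] m' by (simp add: m_def)
    then obtain i j t where ij: "i < n" "j < n" "i \<noteq> j" "le (X j + Y i) (X i + Y j)"
      and t: "m = t + (X i + Y j)"
      using nonminimal_reducible[OF le m'(3,2)] by blast
    define g :: "('v, 'k) mpoly" where
      "g = (if i < j then mon (X i + Y j) - mon (X j + Y i) else mon (X j + Y i) - mon (X i + Y j))"
    have "j < i" if "\<not> i < j"
      using that ij(3) by simp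
    then have "g \<in> ?F"
      using ij(1,2) by (auto simp: g_def minorsI)
    moreover have lead: "lead_mon le g = X i + Y j"
      using lead_mon_mon_diff[OF le swap_neq[OF ij(1-3)] ij(4), where 'k = 'k] by (simp add: g_def)
    moreover have "g \<noteq> 0"
    proof -
      have "keys g \<noteq> {}"
        using keys_mon_diff[OF swap_neq[OF ij(1-3)], where 'k = 'k]
          keys_mon_diff[OF swap_neq[OF ij(2,1)], where 'k = 'k] ij(3)
        by (auto simp: g_def)
      then show ?thesis
        by auto
    qed
    ultimately show ?thesis
      using t by (intro bexI[of _ g]) (auto simp: m_def[symmetric] add.commute)
  qed
  ultimately show ?thesis
    by (auto simp: groebner_basis_def)
qed

text \<open>The only product \<open>X k + Y l\<close> dividing \<open>X i + Y j\<close> is this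
  monomial itself, so its coefficient vanishes on the ideal of the other minors but equals 1 in
  \<open>f\<close>.\<close>

lemma minors_minimally_generate: "minimally_generates (minors X Y n :: ('v, 'k::field) mpoly set)"
  unfolding minimally_generates_def
proof (intro ballI notI)
  let ?F = "minors X Y n :: ('v, 'k) mpoly set"
  fix f
  assume "f \<in> ?F" and f_ideal: "f \<in> ideal_gen (?F - {f})"
  then obtain i j where f: "f = mon (X i + Y j) - mon (X j + Y i)" and ij: "i < j" "j < n"
    by (auto simp: minors_def)
  let ?m = "X i + Y j"
  have factor: "k = i \<and> l = j" if "t + (X k + Y l) = ?m" "k < n" "l < n" for t k l
  proof -
    have "xpow k ?m = (if k = i then 1 else 0)" "ypow l ?m = (if l = j then 1 else 0)"
      using xpow_add[of i j k 0] ypow_add[of i j l 0] that(2,3) ij X_nz Y_nz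
      by (simp_all add: max_power_zero)
    moreover have "xpow k ?m > 0" "ypow l ?m > 0"
      using that(2,3) by (simp_all add: that(1)[symmetric] xpow_add ypow_add)
    ultimately show ?thesis
      by (auto split: if_splits)
  qed
  have "coeff_sum {?m} f = 0"
  proof (rule coeff_sum_ideal_gen[OF f_ideal])
    fix g
    assume "g \<in> ?F - {f}"
    then obtain k l where g: "g = mon (X k + Y l) - mon (X l + Y k)" "k < l" "l < n" "g \<noteq> f"
      by (auto simp: minors_def)
    then have "t + (X k + Y l) \<noteq> ?m" "t + (X l + Y k) \<noteq> ?m" for t
      using factor[of t k l] factor[of t l k] ij f by auto
    then show "\<exists>a b. g = mon a - mon b \<and> (\<forall>t. t + a \<in> {?m} \<longleftrightarrow> t + b \<in> {?m})"
      using g(1) by blast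
  qed
  moreover have "coeff_sum {?m} f = 1"
    using swap_neq[of i j] ij by (simp add: f coeff_sum_diff mon_def coeff_sum_single)
  ultimately show False
    by simp
qed

lemma minors_robust: "robust (minors X Y n :: ('v, 'k::field) mpoly set)"
  by (simp add: robust_def minors_groebner_basis minors_minimally_generate)

end


section \<open>Consequences of irreducibility\<close>

definition scale :: "nat \<Rightarrow> ('v::finite \<Rightarrow>\<^sub>0 nat) \<Rightarrow> ('v \<Rightarrow>\<^sub>0 nat)" where
  "scale c z = Abs_poly_mapping (\<lambda>v. c * lookup z v)"

lemma lookup_scale: "lookup (scale c z) v = c * lookup z v"
  by (simp add: scale_def)

lemma scale_0: "scale 0 z = 0"
  by (rule poly_mapping_eqI) (simp add: lookup_scale)

lemma scale_Suc: "scale (Suc c) z = z + scale c z"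
  by (rule poly_mapping_eqI) (simp add: lookup_scale lookup_add)

lemma mon_scale: "mon (scale c z) = mon z ^ c"
proof (induction c)
  case 0
  show ?case
    by (simp add: scale_0) (simp add: mon_def)
next
  case (Suc c)
  then show ?case
    by (simp add: scale_Suc flip: mon_mult)
qed

text \<open>A shared variable factors out, and the remaining difference of monomials is no unit
  either.\<close>

lemma keys_disjoint_if_irreducible:
  assumes "irreducible (mon a - mon b :: ('v::finite, 'k::field) mpoly)"
  shows "keys a \<inter> keys b = {}"
proof (rule ccontr)
  assume "keys a \<inter> keys b \<noteq> {}"
  then obtain v where v: "v \<in> keys a" "v \<in> keys b"
    by blast
  then obtain a' b' where ab: "a = Poly_Mapping.single v 1 + a'" "b = Poly_Mapping.single v 1 + b'"
    by (metis variable_factor_obtain)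
  then have "mon a - mon b = (mon (Poly_Mapping.single v 1) :: ('v, 'k) mpoly) * (mon a' - mon b')"
    by (simp add: right_diff_distrib mon_mult)
  then show False
    using irreducibleD[OF assms] mon_diff_not_unit[of a' b'] mon_not_unit[OF single_1_not_0] by metis
qed

text \<open>The geometric-sum factorization of a difference of \<open>m\<close>-th powers: for
  \<open>m \<ge> 2\<close> the cofactor \<open>s\<close> has no constant term, so both factors are
  non-units.\<close>

lemma power_diff_not_irreducible:
  assumes "m \<ge> 2" "z \<noteq> 0" "w \<noteq> 0"
  shows "\<not> irreducible (mon (scale m z) - mon (scale m w) :: ('v::finite, 'k::field) mpoly)"
proof
  define s :: "('v, 'k) mpoly" where
    "s = (\<Sum>i<m. mon w ^ (m - Suc i) * mon z ^ i)"
  assume "irreducible (mon (scale m z) - mon (scale m w) :: ('v, 'k) mpoly)"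
  moreover have "mon (scale m z) - mon (scale m w) = (mon z - mon w) * s"
    unfolding mon_scale s_def by (rule power_diff_sumr2)
  moreover have "lookup (mon w ^ (m - Suc i) * mon z ^ i :: ('v, 'k) mpoly) 0 = 0" if "i < m" for i
  proof -
    have "scale (m - Suc i) w + scale i z \<noteq> 0"
    proof
      assume sum_0: "scale (m - Suc i) w + scale i z = 0"
      then have "scale (m - Suc i) w = 0" "scale i z = 0"
        using exponent_add_eq_0 by (metis add.commute)+
      moreover have "c = 0" if "scale c y = 0" "y \<noteq> 0" for c and y :: "'v \<Rightarrow>\<^sub>0 nat"
        using that by (metis lookup_scale lookup_zero mult_eq_0_iff poly_mapping_eqI)
      ultimately have "m - Suc i = 0" "i = 0"
        using assms by blast+
      then show False
        using assms(1) by simp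
    qed
    then show ?thesis
      by (simp add: mon_scale[symmetric] mon_mult lookup_mon)
  qed
  then have "lookup s 0 = 0"
    by (simp add: s_def lookup_sum)
  then have "\<not> s dvd 1"
    by (rule not_unit_if_const_coeff_0)
  ultimately show False
    using mon_diff_not_unit[of z w] irreducibleD by metis
qed

section \<open>Sharing a variable between the rows\<close>

text \<open>Chains of moves along the minors; they certify binomials of the ideal without explicit
  cofactors.\<close>

inductive connected :: "(nat \<Rightarrow> ('v \<Rightarrow>\<^sub>0 nat)) \<Rightarrow> (nat \<Rightarrow> ('v \<Rightarrow>\<^sub>0 nat)) \<Rightarrow> nat \<Rightarrow>
    ('v \<Rightarrow>\<^sub>0 nat) \<Rightarrow> ('v \<Rightarrow>\<^sub>0 nat) \<Rightarrow> bool" for X Y n where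
  refl: "connected X Y n a a"
| step: "i < n \<Longrightarrow> j < n \<Longrightarrow> i \<noteq> j \<Longrightarrow> connected X Y n (t + (X j + Y i)) b \<Longrightarrow>
    connected X Y n (t + (X i + Y j)) b"

lemma connected_trans: "connected X Y n a b \<Longrightarrow> connected X Y n b c \<Longrightarrow> connected X Y n a c"
  by (induction rule: connected.induct) (auto intro: connected.intros)

lemma connected_swap_rows: "connected Y X n a b \<Longrightarrow> connected X Y n a b"
proof (induction rule: connected.induct)
  case (step i j t b)
  then show ?case
    using connected.step[of j n i X Y t b] by (simp add: add.commute)
qed (rule connected.refl)

lemma connected_scale:
  assumes "i < n" "j < n" "i \<noteq> j"
  shows "connected X Y n (t + scale c (X i + Y j)) (t + scale c (X j + Y i))"
proof (induction c arbitrary: t)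
  case 0
  show ?case
    by (simp add: scale_0 connected.refl)
next
  case (Suc c)
  have "connected X Y n (t + scale c (X j + Y i) + (X i + Y j)) (t + scale c (X j + Y i) + (X j + Y i))"
    using assms connected.step connected.refl by blast
  then show ?case
    using Suc[of "t + (X i + Y j)"] connected_trans by (fastforce simp: scale_Suc ac_simps)
qed

lemma mon_diff_in_ideal_if_connected:
  assumes "connected X Y n a b"
  shows "(mon a - mon b :: ('v, 'k::field) mpoly) \<in> ideal_gen (minors X Y n)"
proof -
  let ?F = "minors X Y n :: ('v, 'k) mpoly set"
  have fin: "finite ?F"
  proof -
    have "?F \<subseteq> (\<lambda>(i, j). mon (X i + Y j) - mon (X j + Y i)) ` ({..<n} \<times> {..<n})"
      by (auto simp: minors_def)
    then show ?thesis
      by (rule finite_subset) simp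
  qed
  \<comment> \<open>The differences telescope along the chain. Summing over all of the finite set
    \<open>?F\<close> lets each move update the cofactor of a single generator.\<close>
  have "\<exists>c. mon a - mon b = (\<Sum>f\<in>?F. c f * f)"
    using assms
  proof (induction rule: connected.induct)
    case (refl a)
    show ?case
      by (intro exI[of _ "\<lambda>_. 0"]) simp
  next
    case (step i j t b)
    then obtain c where c: "mon (t + (X j + Y i)) - mon b = (\<Sum>f\<in>?F. c f * f)"
      by blast
    obtain g d where g: "g \<in> ?F" "mon (t + (X i + Y j)) - mon (t + (X j + Y i)) = d * g"
    proof (cases "i < j")
      case True
      then show ?thesis
        using that[of "mon (X i + Y j) - mon (X j + Y i)" "mon t"] step.hyps
        by (simp add: minorsI right_diff_distrib mon_mult)
    next
      case False
      then show ?thesis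
        using that[of "mon (X j + Y i) - mon (X i + Y j)" "- mon t"] step.hyps
        by (simp add: minorsI right_diff_distrib mon_mult)
    qed
    have "(\<Sum>f\<in>?F. (c f + (if f = g then d else 0)) * f) = (\<Sum>f\<in>?F. c f * f) + d * g"
      using g(1) fin by (simp add: distrib_right sum.distrib if_distrib[of "\<lambda>x. x * _"] cong: if_cong)
    also have "\<dots> = mon (t + (X i + Y j)) - mon b"
      by (simp flip: c g(2))
    finally show ?case
      by (intro exI) (rule sym)
  qed
  then show ?thesis
    using fin by (auto simp: ideal_gen_def)
qed

text \<open>The binomial has leading monomial \<open>a\<close>, which the leading monomial of some
  minor divides; \<open>i\<close> and \<open>j\<close> are ordered so that this is
  \<open>X i + Y j\<close>, whatever the sign of the minor.\<close>

lemma reducible_if_groebner_basis: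
  fixes X Y :: "nat \<Rightarrow> ('v \<Rightarrow>\<^sub>0 nat)"
  assumes gb: "groebner_basis le (minors X Y n :: ('v, 'k::field) mpoly set) (ideal_gen (minors X Y n))"
    and le: "term_order le" and "connected X Y n a b" "a \<noteq> b" "le b a"
  shows "\<exists>i<n. \<exists>j<n. i \<noteq> j \<and> le (X j + Y i) (X i + Y j) \<and> (\<exists>t. a = t + (X i + Y j))"
proof -
  let ?f = "mon a - mon b :: ('v, 'k) mpoly"
  have "?f \<noteq> 0"
    using keys_mon_diff[OF assms(4), where 'k = 'k] by auto
  then obtain g c where g: "g \<in> (minors X Y n :: ('v, 'k) mpoly set)" "g \<noteq> 0"
    "lead_mon le ?f = lead_mon le g + c"
    using gb mon_diff_in_ideal_if_connected[OF assms(3), where 'k = 'k]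
    unfolding groebner_basis_def by blast
  then have a: "a = lead_mon le g + c"
    using lead_mon_mon_diff(1)[OF le assms(4,5), where 'k = 'k] by simp
  obtain i j where ij: "i < j" "j < n" "g = mon (X i + Y j) - mon (X j + Y i)"
    using g(1) by (auto simp: minors_def)
  then have ne: "X i + Y j \<noteq> X j + Y i"
    using g(2) by auto
  show ?thesis
  proof (cases "le (X j + Y i) (X i + Y j)")
    case True
    then have "a = c + (X i + Y j)"
      using a ij(3) lead_mon_mon_diff(1)[OF le ne True, where 'k = 'k] by (simp add: add.commute)
    then show ?thesis
      using True ij by (intro exI[of _ i] conjI exI[of _ j]) auto
  next
    case False
    then have le': "le (X i + Y j) (X j + Y i)"
      using term_orderD(4)[OF le] by blast
    then have "a = c + (X j + Y i)"
      using a ij(3) lead_mon_mon_diff(2)[OF le ne[symmetric] le', where 'k = 'k]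
      by (simp add: add.commute)
    then show ?thesis
      using le' ij by (intro exI[of _ j] conjI exI[of _ i]) auto
  qed
qed

section \<open>Eliminating a shared variable\<close>

text \<open>If \<open>u\<close> divides \<open>X\<^sub>p\<close> and \<open>Y\<^sub>q\<close> with exponents \<open>\<alpha>\<close> and \<open>\<beta>\<close>, cancelling \<open>u\<^bsup>\<alpha>\<beta>\<^esup>\<close> between
  \<open>X\<^sub>p\<^sup>\<beta>\<close> and \<open>Y\<^sub>q\<^sup>\<alpha>\<close> leaves a binomial \<open>P X\<^sub>q\<^sup>\<alpha> Y\<^sub>k\<^bsup>\<alpha>+\<beta>\<^esup> - Q Y\<^sub>p\<^sup>\<beta> X\<^sub>k\<^bsup>\<alpha>+\<beta>\<^esup>\<close> of the ideal, free of \<open>u\<close>. This is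
  its first term; exchanging the rows and \<open>p\<close>, \<open>q\<close> yields the second one.\<close>

definition cancelled_term :: "(nat \<Rightarrow> ('v::finite \<Rightarrow>\<^sub>0 nat)) \<Rightarrow> (nat \<Rightarrow> ('v \<Rightarrow>\<^sub>0 nat)) \<Rightarrow> nat \<Rightarrow> nat \<Rightarrow>
    nat \<Rightarrow> 'v \<Rightarrow> ('v \<Rightarrow>\<^sub>0 nat)" where
  "cancelled_term X Y p q k u = Abs_poly_mapping (\<lambda>v.
     (lookup (Y q) u * lookup (X p) v - (if v = u then lookup (X p) u * lookup (Y q) u else 0))
     + lookup (X p) u * lookup (X q) v + (lookup (X p) u + lookup (Y q) u) * lookup (Y k) v)"

lemma lookup_cancelled_term:
  "lookup (cancelled_term X Y p q k u) v =
     (lookup (Y q) u * lookup (X p) v - (if v = u then lookup (X p) u * lookup (Y q) u else 0))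
     + lookup (X p) u * lookup (X q) v + (lookup (X p) u + lookup (Y q) u) * lookup (Y k) v"
  by (simp add: cancelled_term_def)

text \<open>First \<open>al\<close> moves between columns \<open>q\<close> and \<open>k\<close>,
  then \<open>be\<close> moves between \<open>p\<close> and \<open>k\<close>.\<close>

lemma connected_cancelled_terms:
  assumes "p < n" "q < n" "k < n" "k \<noteq> p" "k \<noteq> q"
  shows "connected X Y n (cancelled_term X Y p q k u) (cancelled_term Y X q p k u)"
proof -
  define al be where "al = lookup (X p) u" and "be = lookup (Y q) u"
  define P where "P = Abs_poly_mapping (\<lambda>v. be * lookup (X p) v - (if v = u then al * be else 0))"
  define Q where "Q = Abs_poly_mapping (\<lambda>v. al * lookup (Y q) v - (if v = u then al * be else 0))"
  have P: "lookup P v = be * lookup (X p) v - (if v = u then al * be else 0)" for v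
    by (simp add: P_def)
  have Q: "lookup Q v = al * lookup (Y q) v - (if v = u then al * be else 0)" for v
    by (simp add: Q_def)
  have "cancelled_term X Y p q k u = (P + scale be (Y k)) + scale al (X q + Y k)"
    by (rule poly_mapping_eqI)
      (simp add: lookup_cancelled_term P lookup_add lookup_scale al_def be_def algebra_simps)
  \<comment> \<open>At the junction the cancelled power of \<open>u\<close> passes from
    \<open>Y q\<close> to \<open>X p\<close>: \<open>P\<close> with \<open>al\<close> copies of
    \<open>Y q\<close> equals \<open>Q\<close> with \<open>be\<close> copies of
    \<open>X p\<close>.\<close>
  moreover have "(P + scale be (Y k)) + scale al (X k + Y q) = (Q + scale al (X k)) + scale be (X p + Y k)"
    by (rule poly_mapping_eqI)
      (simp add: P Q lookup_add lookup_scale al_def be_def algebra_simps)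
  moreover have "(Q + scale al (X k)) + scale be (X k + Y p) = cancelled_term Y X q p k u"
    by (rule poly_mapping_eqI)
      (simp add: lookup_cancelled_term Q lookup_add lookup_scale al_def be_def algebra_simps)
  ultimately show ?thesis
    using connected_scale[of q n k X Y "P + scale be (Y k)" al]
      connected_scale[of p n k X Y "Q + scale al (X k)" be] assms connected_trans
    by (metis (no_types))
qed

lemma exists_third:
  assumes "n \<ge> (3::nat)"
  shows "\<exists>k<n. k \<noteq> p \<and> k \<noteq> q"
proof -
  have "\<exists>k\<in>{0, 1, 2 :: nat}. k \<noteq> p \<and> k \<noteq> q"
    by auto
  moreover have "{0, 1, 2} \<subseteq> {..<n}"
    using assms by auto
  ultimately show ?thesis
    by blast
qed

text \<open>The Groebner property is kept only as divisibility for connected monomials, a form that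
  is symmetric in the two rows.\<close>

locale reducible_matrix =
  fixes X Y :: "nat \<Rightarrow> ('v::finite \<Rightarrow>\<^sub>0 nat)" and n :: nat
  assumes n_ge_3: "n \<ge> 3"
    and X_nz: "i < n \<Longrightarrow> X i \<noteq> 0" and Y_nz: "i < n \<Longrightarrow> Y i \<noteq> 0"
    and XX: "i < n \<Longrightarrow> j < n \<Longrightarrow> i \<noteq> j \<Longrightarrow> keys (X i) \<inter> keys (X j) = {}"
    and YY: "i < n \<Longrightarrow> j < n \<Longrightarrow> i \<noteq> j \<Longrightarrow> keys (Y i) \<inter> keys (Y j) = {}"
    and column: "i < n \<Longrightarrow> keys (X i) \<inter> keys (Y i) = {}"
    and reducible: "term_order le \<Longrightarrow> connected X Y n a b \<Longrightarrow> a \<noteq> b \<Longrightarrow> le b a \<Longrightarrow>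
      \<exists>i<n. \<exists>j<n. i \<noteq> j \<and> le (X j + Y i) (X i + Y j) \<and> (\<exists>t. a = t + (X i + Y j))"
begin

lemma swap_rows: "reducible_matrix Y X n"
proof
  fix le :: "('v \<Rightarrow>\<^sub>0 nat) \<Rightarrow> ('v \<Rightarrow>\<^sub>0 nat) \<Rightarrow> bool" and a b
  assume "term_order le" "connected Y X n a b" "a \<noteq> b" "le b a"
  then obtain i j where ij: "i < n" "j < n" "i \<noteq> j" "le (X j + Y i) (X i + Y j)"
    "\<exists>t. a = t + (X i + Y j)"
    using reducible connected_swap_rows by blast
  then show "\<exists>i<n. \<exists>j<n. i \<noteq> j \<and> le (Y j + X i) (Y i + X j) \<and> (\<exists>t. a = t + (Y i + X j))"
    by (intro exI[of _ j] exI[of _ i] conjI) (auto simp: add.commute)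
qed (use n_ge_3 X_nz Y_nz XX YY column in \<open>auto simp: Int_commute\<close>)

section \<open>Supports and exponents of columns that share a variable\<close>

lemma X_eq_if_common: "i < n \<Longrightarrow> j < n \<Longrightarrow> v \<in> keys (X i) \<Longrightarrow> v \<in> keys (X j) \<Longrightarrow> i = j"
  using XX by blast

lemma Y_eq_if_common: "i < n \<Longrightarrow> j < n \<Longrightarrow> v \<in> keys (Y i) \<Longrightarrow> v \<in> keys (Y j) \<Longrightarrow> i = j"
  using YY by blast

lemma X_ne: "i < n \<Longrightarrow> \<exists>v. v \<in> keys (X i)"
  using X_nz keys_empty_iff by blast

lemma Y_ne: "i < n \<Longrightarrow> \<exists>v. v \<in> keys (Y i)"
  using Y_nz keys_empty_iff by blast

lemma cancelled_term_free:
  assumes "p < n" "q < n" "k < n" "k \<noteq> p" "k \<noteq> q" "p \<noteq> q" "u \<in> keys (X p)" "u \<in> keys (Y q)"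
  shows "lookup (cancelled_term X Y p q k u) u = 0"
proof -
  have "u \<notin> keys (X q)" "u \<notin> keys (Y k)"
    using assms XX[of p q] YY[of k q] by blast+
  then show ?thesis
    by (simp add: lookup_cancelled_term in_keys_iff mult.commute)
qed

lemma reducer_of_cancelled_term:
  assumes pqk: "p < n" "q < n" "k < n" "k \<noteq> p" "k \<noteq> q" "p \<noteq> q"
    and u: "u \<in> keys (X p)" "u \<in> keys (Y q)"
    and le: "term_order (lex_le (u # us))"
    and lead: "cancelled_term X Y p q k u \<noteq> cancelled_term Y X q p k u"
      "lex_le (u # us) (cancelled_term Y X q p k u) (cancelled_term X Y p q k u)"
  obtains i j where "i < n" "j < n" "i \<notin> {p, q, k}" "j \<notin> {p, q}" "keys (X i) \<subseteq> keys (Y k)"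
    "j = k \<or> keys (Y j) \<subseteq> keys (X p) \<union> keys (X q)" "lex_le (u # us) (X j + Y i) (X i + Y j)"
proof -
  let ?A = "cancelled_term X Y p q k u"
  obtain i j t where ij: "i < n" "j < n" "i \<noteq> j" and ij_le: "lex_le (u # us) (X j + Y i) (X i + Y j)"
    and t: "?A = t + (X i + Y j)"
    using reducible[OF le connected_cancelled_terms[OF pqk(1-5)] lead] by blast
  have "lookup (X i) u = 0" "lookup (Y j) u = 0"
    using cancelled_term_free[OF pqk u] by (simp_all add: t lookup_add)
  \<comment> \<open>As \<open>u\<close> dominates the order, the smaller term of the minor is also
    free of \<open>u\<close>. Since \<open>u\<close> occurs in \<open>X p\<close> and
    \<open>Y q\<close>, columns \<open>p\<close> and \<open>q\<close> are excluded.\<close>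
  moreover from this have "lookup (X j) u = 0" "lookup (Y i) u = 0"
    using ij_le by (auto simp: lookup_add)
  ultimately have ij_pq: "i \<notin> {p, q}" "j \<notin> {p, q}"
    using u by (auto simp: in_keys_iff)
  have keys_A: "keys ?A \<subseteq> keys (X p) \<union> keys (X q) \<union> keys (Y k)"
    by (auto simp: in_keys_iff lookup_cancelled_term split: if_splits)
  have "keys (X i) \<subseteq> keys ?A" "keys (Y j) \<subseteq> keys ?A"
    by (auto simp: t in_keys_iff lookup_add)
  then have "keys (X i) \<subseteq> keys (Y k)" "j = k \<or> keys (Y j) \<subseteq> keys (X p) \<union> keys (X q)"
    using keys_A XX[of i p] XX[of i q] YY[of j k] ij ij_pq pqk by blast+
  moreover from this have "i \<noteq> k"
    using column[OF ij(1)] X_ne[OF ij(1)] by blast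
  ultimately show ?thesis
    using that[of i j] ij ij_pq ij_le by blast
qed

lemma exists_X_subset_Y:
  assumes pqk: "p < n" "q < n" "k < n" "k \<noteq> p" "k \<noteq> q" "p \<noteq> q"
    and u: "u \<in> keys (X p)" "u \<in> keys (Y q)"
  shows "\<exists>i<n. i \<notin> {p, q, k} \<and> keys (X i) \<subseteq> keys (Y k)"
proof -
  let ?A = "cancelled_term X Y p q k u" and ?B = "cancelled_term Y X q p k u"
  obtain v where v: "v \<in> keys (Y k)"
    using Y_ne pqk by blast
  obtain us :: "'v list" where us: "\<And>vs. term_order (lex_le (vs @ us))"
    using exists_lex_le by blast
  have "v \<notin> keys (Y q)" "v \<notin> keys (Y p)" "v \<notin> keys (X k)"
    using v pqk column[of k] YY[of k p] YY[of k q] by blast+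
  then have "lookup ?B v = 0"
    by (simp add: lookup_cancelled_term in_keys_iff)
  moreover have "lookup ?A v > 0"
    using v u by (auto simp: lookup_cancelled_term in_keys_iff)
  moreover have "lookup ?A u = 0" "lookup ?B u = 0"
    using cancelled_term_free[OF pqk u]
      reducible_matrix.cancelled_term_free[OF swap_rows, of q p k u] pqk u by auto
  \<comment> \<open>Both terms are free of \<open>u\<close>, so \<open>v\<close>, which occurs only
    in \<open>?A\<close>, decides which one leads.\<close>
  ultimately have "?A \<noteq> ?B" "lex_le (u # v # us) ?B ?A"
    by auto
  then show ?thesis
    using reducer_of_cancelled_term[OF pqk u, of "v # us"] us[of "[u, v]"] by (metis append_Cons append_Nil)
qed

text \<open>The previous inclusion, with the rows exchanged and then once more for the column found,
  gives \<open>X i\<close> inside \<open>Y j\<close> inside \<open>X k\<close>; disjointness within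
  the row forces \<open>i = k\<close>.\<close>

lemma exists_Y_eq_X:
  assumes pqk: "p < n" "q < n" "k < n" "k \<noteq> p" "k \<noteq> q" "p \<noteq> q"
    and u: "u \<in> keys (X p)" "u \<in> keys (Y q)"
  shows "\<exists>j<n. j \<notin> {p, q, k} \<and> keys (Y j) = keys (X k)"
proof -
  obtain j where j: "j < n" "j \<notin> {p, q, k}" "keys (Y j) \<subseteq> keys (X k)"
    using reducible_matrix.exists_X_subset_Y[OF swap_rows, of q p k u] pqk u by auto
  then obtain i where i: "i < n" "keys (X i) \<subseteq> keys (Y j)"
    using exists_X_subset_Y[of p q j u] pqk u by auto
  then have "i = k"
    using X_ne[of i] X_eq_if_common[of i k] j pqk by blast
  then show ?thesis
    using i j by blast
qed

lemma keys_eq_if_common: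
  assumes pq: "p < n" "q < n" "p \<noteq> q" and u: "u \<in> keys (X p)" "u \<in> keys (Y q)"
  shows "keys (X p) = keys (Y q)" "keys (X q) = keys (Y p)"
proof -
  obtain k where k: "k < n" "k \<noteq> p" "k \<noteq> q"
    using exists_third[OF n_ge_3] by blast
  then obtain j where j: "j < n" "j \<notin> {p, q, k}" "keys (Y j) = keys (X k)"
    using exists_Y_eq_X[of p q k u] pq u by blast
  \<comment> \<open>Columns \<open>k\<close> and \<open>j\<close> now share a variable themselves,
    so \<open>p\<close> and \<open>q\<close> can take the role of further columns.\<close>
  obtain w where w: "w \<in> keys (X k)" "w \<in> keys (Y j)"
    using X_ne[OF k(1)] j by blast
  obtain l where "l < n" "keys (Y l) = keys (X p)"
    using exists_Y_eq_X[of k j p w] k j pq w by auto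
  moreover from this have "l = q"
    using Y_eq_if_common[of l q u] u pq by blast
  ultimately show "keys (X p) = keys (Y q)"
    by simp
  obtain m where m: "m < n" "m \<noteq> q" "keys (Y m) = keys (X q)"
    using exists_Y_eq_X[of k j q w] k j pq w by auto
  \<comment> \<open>Otherwise \<open>m\<close> is a further column for \<open>p\<close>,
    \<open>q\<close>, and the exchanged rows yield a second \<open>X i\<close> with the support of
    \<open>X q\<close>.\<close>
  have "m = p"
  proof (rule ccontr)
    assume "m \<noteq> p"
    then obtain i where "i < n" "i \<noteq> q" "keys (X i) = keys (Y m)"
      using reducible_matrix.exists_Y_eq_X[OF swap_rows, of q p m u] pq u m by auto
    then show False
      using m X_ne[of q] X_eq_if_common[of i q] pq by blast
  qed
  then show "keys (X q) = keys (Y p)"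
    using m by simp
qed

text \<open>The two sides are the exponents of \<open>t\<close> in the two cancelled terms. Were the
  left one larger, \<open>?A\<close> would lead when \<open>t\<close> comes second after
  \<open>u\<close>; the supports then force \<open>j = k\<close>, and placing \<open>w\<close> from
  \<open>X k\<close> third makes the dividing term the smaller one of its minor.\<close>

lemma exponents_le:
  assumes pq: "p < n" "q < n" "p \<noteq> q" and u: "u \<in> keys (X p)" "u \<in> keys (Y q)"
    and t: "t \<in> keys (X q)"
  shows "lookup (X p) u * lookup (X q) t \<le> lookup (Y q) u * lookup (Y p) t"
proof (rule ccontr)
  assume gt: "\<not> ?thesis"
  obtain k where k: "k < n" "k \<noteq> p" "k \<noteq> q"
    using exists_third[OF n_ge_3] by blast
  note keys_eq = keys_eq_if_common[OF pq u]
  let ?A = "cancelled_term X Y p q k u" and ?B = "cancelled_term Y X q p k u"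
  obtain w where w: "w \<in> keys (X k)"
    using X_ne k by blast
  obtain us :: "'v list" where us: "\<And>vs. term_order (lex_le (vs @ us))"
    using exists_lex_le by blast
  have t_free: "t \<notin> keys (X i)" "u \<notin> keys (X i)" "t \<notin> keys (Y i)" "u \<notin> keys (Y i)"
    if "i < n" "i \<notin> {p, q}" for i
    using that t u keys_eq XX[of i q] XX[of i p] YY[of i p] YY[of i q] pq by blast+
  have "t \<noteq> u" "t \<notin> keys (X p)" "t \<notin> keys (Y q)"
    using t u XX[OF pq] column[OF pq(2)] by blast+
  then have "lookup ?A t = lookup (X p) u * lookup (X q) t"
    and "lookup ?B t = lookup (Y q) u * lookup (Y p) t"
    using t_free[of k] k by (simp_all add: lookup_cancelled_term in_keys_iff)
  then have "lookup ?B t < lookup ?A t"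
    using gt by simp
  moreover have "lookup ?A u = 0" "lookup ?B u = 0"
    using cancelled_term_free[OF pq(1,2) k pq(3) u]
      reducible_matrix.cancelled_term_free[OF swap_rows, of q p k u] pq k u by auto
  ultimately have "?A \<noteq> ?B" "lex_le (u # t # w # us) ?B ?A"
    by auto
  moreover have "term_order (lex_le (u # t # w # us))"
    using us[of "[u, t, w]"] by simp
  ultimately obtain i j where ij: "i < n" "j < n" "i \<notin> {p, q, k}" "j \<notin> {p, q}"
    "j = k \<or> keys (Y j) \<subseteq> keys (X p) \<union> keys (X q)"
    "lex_le (u # t # w # us) (X j + Y i) (X i + Y j)"
    using reducer_of_cancelled_term[OF pq(1,2) k pq(3) u] by metis
  have "j = k"
  proof (rule ccontr)
    assume "j \<noteq> k"
    then have "keys (Y j) \<subseteq> keys (Y p) \<union> keys (Y q)"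
      using ij(5) keys_eq by blast
    then show False
      using Y_ne[OF ij(2)] YY[OF ij(2), of p] YY[OF ij(2), of q] ij(4) pq by blast
  qed
  moreover have "w \<notin> keys (X i)" "w \<notin> keys (Y k)"
    using w ij XX[of i k] column[of k] k by blast+
  \<comment> \<open>Columns \<open>i\<close> and \<open>k\<close> contain neither \<open>u\<close>
    nor \<open>t\<close>, so \<open>w\<close> decides in favour of \<open>X k + Y i\<close>.\<close>
  ultimately show False
    using ij t_free[of i] t_free[of k] w k by (auto simp: lookup_add in_keys_iff)
qed

lemma exponents_eq:
  assumes pq: "p < n" "q < n" "p \<noteq> q" and u: "u \<in> keys (X p)" "u \<in> keys (Y q)"
    and t: "t \<in> keys (X q)"
  shows "lookup (X p) u * lookup (X q) t = lookup (Y q) u * lookup (Y p) t"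
proof (rule antisym)
  show "lookup (Y q) u * lookup (Y p) t \<le> lookup (X p) u * lookup (X q) t"
    using reducible_matrix.exponents_le[OF swap_rows, of q p u t] keys_eq_if_common[OF pq u] assms by auto
qed (rule exponents_le[OF assms])

text \<open>The exponents of \<open>X p\<close> to \<open>Y q\<close>, and of \<open>Y p\<close> to
  \<open>X q\<close>, are in one constant ratio, in lowest terms \<open>a'\<close> to
  \<open>b'\<close>. Hence both terms of the minor are powers with exponent
  \<open>a' + b'\<close>.\<close>

lemma minor_is_power_diff:
  assumes pq: "p < n" "q < n" "p \<noteq> q" and common: "keys (X p) \<inter> keys (Y q) \<noteq> {}"
  obtains m z w where "m \<ge> 2" "z \<noteq> 0" "w \<noteq> 0" "X p + Y q = scale m z" "X q + Y p = scale m w"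
proof -
  obtain u where u: "u \<in> keys (X p)" "u \<in> keys (Y q)"
    using common by blast
  obtain t where t: "t \<in> keys (X q)"
    using X_ne pq by blast
  note keys_eq = keys_eq_if_common[OF pq u]
  define a b g where "a = lookup (X p) u" and "b = lookup (Y q) u" and "g = gcd a b"
  have pos: "a > 0" "b > 0" "lookup (Y p) t > 0"
    using u t keys_eq by (auto simp: a_def b_def in_keys_iff)
  obtain a' b' where ab: "a = a' * g" "b = b' * g" "coprime a' b'"
    using gcd_coprime_exists[of a b] pos(1) unfolding g_def by (metis gcd_pos_nat neq0_conv)
  have "a' > 0" "b' > 0" "g > 0"
    using ab(1,2) pos(1,2) by (metis gr0I mult_is_0)+
  have row1: "a' * lookup (X q) v = b' * lookup (Y p) v" for v
  proof (cases "v \<in> keys (X q)")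
    case True
    then show ?thesis
      using exponents_eq[OF pq u True] \<open>g > 0\<close> by (simp add: a_def[symmetric] b_def[symmetric] ab)
  next
    case False
    moreover from this have "v \<notin> keys (Y p)"
      using keys_eq by blast
    ultimately show ?thesis
      by (simp add: in_keys_iff)
  qed
  have row2: "b' * lookup (X p) v = a' * lookup (Y q) v" for v
  proof (cases "v \<in> keys (X p)")
    case True
    \<comment> \<open>The variable \<open>v\<close> replaces \<open>u\<close> while \<open>t\<close>
      stays fixed, so every \<open>v\<close> gets the same ratio.\<close>
    then have "lookup (X p) v * lookup (X q) t = lookup (Y q) v * lookup (Y p) t"
      using exponents_eq[OF pq True _ t] keys_eq by blast
    then have "lookup (X p) v * (a' * lookup (X q) t) = a' * lookup (Y q) v * lookup (Y p) t"
      by (simp add: ac_simps)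
    then show ?thesis
      using pos(3) by (simp add: row1 ac_simps)
  next
    case False
    moreover from this have "v \<notin> keys (Y q)"
      using keys_eq by blast
    ultimately show ?thesis
      by (simp add: in_keys_iff)
  qed
  define z where "z = Abs_poly_mapping (\<lambda>v. lookup (X p) v div a')"
  define w where "w = Abs_poly_mapping (\<lambda>v. lookup (Y p) v div a')"
  \<comment> \<open>\<open>a'\<close> divides \<open>b'\<close> times this exponent and is coprime
    to \<open>b'\<close>, so the division defining \<open>z\<close> is exact.\<close>
  have "a' dvd lookup (X p) v" for v
    using row2[of v] ab(3) by (metis coprime_dvd_mult_right_iff dvd_triv_left)
  then have Xp: "lookup (X p) v = a' * lookup z v" for v
    by (simp add: z_def)
  then have Yq: "lookup (Y q) v = b' * lookup z v" for v
    using row2[of v] \<open>a' > 0\<close> by simp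
  have "a' dvd lookup (Y p) v" for v
    using row1[of v] ab(3) by (metis coprime_dvd_mult_right_iff dvd_triv_left)
  then have Yp: "lookup (Y p) v = a' * lookup w v" for v
    by (simp add: w_def)
  then have Xq: "lookup (X q) v = b' * lookup w v" for v
    using row1[of v] \<open>a' > 0\<close> by simp
  show ?thesis
  proof (rule that[of "a' + b'" z w])
    show "a' + b' \<ge> 2"
      using \<open>a' > 0\<close> \<open>b' > 0\<close> by simp
    show "z \<noteq> 0" "w \<noteq> 0"
      using Xp[of u] u Xq[of t] t by (auto simp: in_keys_iff)
    show "X p + Y q = scale (a' + b') z" "X q + Y p = scale (a' + b') w"
      by (rule poly_mapping_eqI; simp add: lookup_add lookup_scale Xp Yq Xq Yp distrib_right)+
  qed
qed

end

section \<open>The equivalence for irreducible minors\<close>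

theorem theorem4p1:
  fixes X Y :: "nat \<Rightarrow> ('v::finite \<Rightarrow>\<^sub>0 nat)" and n :: nat
  assumes "n \<ge> 3"
    and "\<forall>i<n. X i \<noteq> 0 \<and> Y i \<noteq> 0"
    and "\<forall>f\<in>{mon (X i) * mon (Y j) - mon (X j) * mon (Y i) | i j. i < j \<and> j < n}.
           binomial (f :: ('v, 'k::field) mpoly) \<and> irreducible f"
  shows "robust {mon (X i) * mon (Y j) - mon (X j) * mon (Y i) :: ('v, 'k) mpoly | i j. i < j \<and> j < n}
     \<longleftrightarrow> (\<forall>i<n. \<forall>j<n. rel_prime (mon (X i) :: ('v, 'k) mpoly) (mon (Y j)) \<and>
            (i \<noteq> j \<longrightarrow> rel_prime (mon (X i) :: ('v, 'k) mpoly) (mon (X j)) \<and>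
                       rel_prime (mon (Y i) :: ('v, 'k) mpoly) (mon (Y j))))"
proof -
  let ?F = "minors X Y n :: ('v, 'k) mpoly set"
  have F: "{mon (X i) * mon (Y j) - mon (X j) * mon (Y i) :: ('v, 'k) mpoly | i j. i < j \<and> j < n} = ?F"
    by (simp add: minors_def mon_mult)
  have irred: "irreducible (mon (X i + Y j) - mon (X j + Y i) :: ('v, 'k) mpoly)"
    if "i < j" "j < n" for i j
    using assms(3) that unfolding F by (auto simp: minors_def)
  have disj: "keys (X i + Y j) \<inter> keys (X j + Y i) = {}" if "i < n" "j < n" "i \<noteq> j" for i j
    using keys_disjoint_if_irreducible[OF irred[of i j]] keys_disjoint_if_irreducible[OF irred[of j i]] that
    by (cases "i < j") auto
  have keys_plus: "keys (a + b) = keys a \<union> keys b" for a b :: "'v \<Rightarrow>\<^sub>0 nat"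
    by (auto simp: in_keys_iff lookup_add)
  \<comment> \<open>Disjointness of the two terms of a minor separates entries within a row and also
    the entries of one column.\<close>
  have XX: "keys (X i) \<inter> keys (X j) = {}" and YY: "keys (Y i) \<inter> keys (Y j) = {}"
    if "i < n" "j < n" "i \<noteq> j" for i j
    using disj[OF that] by (auto simp: keys_plus)
  have column: "keys (X i) \<inter> keys (Y i) = {}" if "i < n" for i
  proof -
    obtain j where "j < n" "i \<noteq> j"
      using exists_third[OF assms(1), of i i] by blast
    then show ?thesis
      using disj[OF that] by (auto simp: keys_plus)
  qed
  show ?thesis
    unfolding F rel_prime_mon_iff
  proof
    assume robust: "robust ?F"
    interpret reducible_matrix X Y n
    proof
      fix le :: "('v \<Rightarrow>\<^sub>0 nat) \<Rightarrow> ('v \<Rightarrow>\<^sub>0 nat) \<Rightarrow> bool" and a b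
      assume le: "term_order le" and ab: "connected X Y n a b" "a \<noteq> b" "le b a"
      have "groebner_basis le ?F (ideal_gen ?F)"
        using robust le by (simp add: robust_def)
      then show "\<exists>i<n. \<exists>j<n. i \<noteq> j \<and> le (X j + Y i) (X i + Y j) \<and> (\<exists>t. a = t + (X i + Y j))"
        using le ab by (rule reducible_if_groebner_basis)
    qed (use assms(1,2) XX YY column in auto)
    have "keys (X p) \<inter> keys (Y q) = {}" if pq: "p < n" "q < n" "p \<noteq> q" for p q
    proof (rule ccontr)
      assume "keys (X p) \<inter> keys (Y q) \<noteq> {}"
      then obtain m z w where m: "m \<ge> 2" "z \<noteq> 0" "w \<noteq> 0"
        "X p + Y q = scale m z" "X q + Y p = scale m w"
        using minor_is_power_diff[OF pq] by blast
      \<comment> \<open>Only one sign of the minor is listed, so for \<open>q < p\<close> the roles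
        of \<open>z\<close> and \<open>w\<close> are exchanged.\<close>
      show False
      proof (cases "p < q")
        case True
        then show ?thesis
          using irred[OF True pq(2)] power_diff_not_irreducible[OF m(1-3), where 'k = 'k] by (simp add: m)
      next
        case False
        then show ?thesis
          using irred[of q p] pq power_diff_not_irreducible[OF m(1,3,2), where 'k = 'k] by (simp add: m)
      qed
    qed
    then show "\<forall>i<n. \<forall>j<n. keys (X i) \<inter> keys (Y j) = {} \<and>
        (i \<noteq> j \<longrightarrow> keys (X i) \<inter> keys (X j) = {} \<and> keys (Y i) \<inter> keys (Y j) = {})"
      using XX YY column by metis
  next
    assume "\<forall>i<n. \<forall>j<n. keys (X i) \<inter> keys (Y j) = {} \<and>
        (i \<noteq> j \<longrightarrow> keys (X i) \<inter> keys (X j) = {} \<and> keys (Y i) \<inter> keys (Y j) = {})"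
    then interpret coprime_matrix X Y n
      using assms(2) by unfold_locales auto
    show "robust ?F"
      by (rule minors_robust)
  qed
qed

end
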